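(* Let $a,b,c,d,e,g\in\mathbb{R}$ with $ac-b^2<0$, let $f:\mathbb{R}^2\to\mathbb{R}$ be the quadratic function $f(x,y)=ax^2+2bxy+cy^2+dx+ey+g$, and let $\varepsilon>0$. Then there is a triangulation $\mathcal{T}$ of the plane and a function $\hat f:\mathbb{R}^2\to\mathbb{R}$ that is piecewise linear with respect to $\mathcal{T}$, such that $|f(x,y)-\hat f(x,y)|\le\varepsilon$ for all $(x,y)\in\mathbb{R}^2$ and $\mathcal{T}$ has triangle density $$\frac{\sqrt3}{4}\cdot\sqrt{b^2-ac}\cdot\frac1\varepsilon .$$ The triangulation $\mathcal{T}$ can be taken to be a triangular grid of congruent triangles. This grid can be freely translated in the plane: for every $t\in\mathbb{R}^2$, the translated grid $\mathcal{T}+t$ also carries a piecewise linear function with vertical error at most $\varepsilon$ from $f$ (and it has the same triangle density). In addition, there is a one-parameter family of such triangular grids, of different shapes (that is, a family indexed continuously by a nondegenerate real interval, whose triangles are pairwise non-congruent for different parameter values), each with the same properties (same error bound, same triangle density, free translatability).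
   Context: A function $\hat f:\mathbb{R}^2\to\mathbb{R}$ is piecewise linear with respect to a triangulation $\mathcal{T}$ of the plane if it is continuous and its restriction to each triangle of $\mathcal{T}$ is affine; it is determined by its values at the vertices of $\mathcal{T}$, which are arbitrary (they need not equal the values of $f$). For $r>0$ let $Q_r=[-r/2,r/2]\times[-r/2,r/2]$. The triangle density of a triangulation $\mathcal{T}$ of the plane is $$\limsup_{r\to\infty}\frac{|\{T\in\mathcal{T}\mid T\cap Q_r\neq\emptyset\}|}{r^2}.$$ A triangular grid is a triangulation of the plane for which there are a point $p\in\mathbb{R}^2$ and linearly independent vectors $u,v\in\mathbb{R}^2$ such that its triangles are exactly $p+iu+jv+\operatorname{conv}\{0,u,v\}$ and $p+iu+jv+\operatorname{conv}\{u,v,u+v\}$ for $i,j\in\mathbb{Z}$; all its triangles are congruent. For $t\in\mathbb{R}^2$, $\mathcal{T}+t$ denotes the triangulation consisting of the triangles $T+t$, $T\in\mathcal{T}$. *)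

theory Defs
  imports "HOL-Analysis.Analysis"
begin

text \<open>
  The plane is \<^typ>\<open>real \<times> real\<close> with its Euclidean norm.  A triangulation is given by its
  set of (closed, nondegenerate) triangles; it is face-to-face and locally finite.
  The library's \<open>triangulation\<close> is not applicable, since it only admits finite complexes.
\<close>

definition plane_triangulation :: "(real \<times> real) set set \<Rightarrow> bool" where
  "plane_triangulation \<T> \<longleftrightarrow>
     (\<forall>T\<in>\<T>. 2 simplex T) \<and>
     \<Union>\<T> = UNIV \<and>
     (\<forall>T\<in>\<T>. \<forall>T'\<in>\<T>. T \<inter> T' face_of T \<and> T \<inter> T' face_of T') \<and>
     locally_finite_in euclidean \<T>"

definition piecewise_linear_wrt :: "(real \<times> real) set set \<Rightarrow> (real \<times> real \<Rightarrow> real) \<Rightarrow> bool" where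
  "piecewise_linear_wrt \<T> h \<longleftrightarrow>
     continuous_on UNIV h \<and>
     (\<forall>T\<in>\<T>. \<exists>l k. linear l \<and> (\<forall>z\<in>T. h z = l z + k))"

definition centered_square :: "real \<Rightarrow> (real \<times> real) set" where
  "centered_square r = {- r / 2 .. r / 2} \<times> {- r / 2 .. r / 2}"

text \<open>
  The limes superior is taken in the extended reals, so it always exists.  For a
  triangulation the set that is counted is finite, because \<^term>\<open>centered_square r\<close> is
  compact and the triangulation is locally finite; hence \<^const>\<open>card\<close> is its true cardinality.
\<close>

definition triangle_density :: "(real \<times> real) set set \<Rightarrow> ereal" where
  "triangle_density \<T> =
     Limsup at_top (\<lambda>r::real. ereal (real (card {T\<in>\<T>. T \<inter> centered_square r \<noteq> {}}) / r\<^sup>2))"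

definition grid_triangles ::
  "real \<times> real \<Rightarrow> real \<times> real \<Rightarrow> real \<times> real \<Rightarrow> (real \<times> real) set set" where
  "grid_triangles p u v =
     (\<Union>i::int. \<Union>j::int.
        {(+) (p + of_int i *\<^sub>R u + of_int j *\<^sub>R v) ` (convex hull {0, u, v}),
         (+) (p + of_int i *\<^sub>R u + of_int j *\<^sub>R v) ` (convex hull {u, v, u + v})})"

text \<open>The condition \<open>u \<noteq> v\<close> is needed because \<^term>\<open>independent {u, u}\<close> holds for nonzero \<open>u\<close>.\<close>

definition triangular_grid :: "(real \<times> real) set set \<Rightarrow> bool" where
  "triangular_grid \<T> \<longleftrightarrow>
     plane_triangulation \<T> \<and>
     (\<exists>p u v. u \<noteq> v \<and> independent {u, v} \<and> \<T> = grid_triangles p u v)"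

definition translate_triangles ::
  "real \<times> real \<Rightarrow> (real \<times> real) set set \<Rightarrow> (real \<times> real) set set" where
  "translate_triangles t \<T> = (\<lambda>T. (+) t ` T) ` \<T>"

definition congruent_sets :: "(real \<times> real) set \<Rightarrow> (real \<times> real) set \<Rightarrow> bool" where
  "congruent_sets S T \<longleftrightarrow>
     (\<exists>h :: real \<times> real \<Rightarrow> real \<times> real. (\<forall>x y. dist (h x) (h y) = dist x y) \<and> h ` S = T)"

text \<open>
  A triangular grid of congruent triangles which, in every translated position (including
  \<open>t = 0\<close>), has triangle density \<open>D\<close> and carries a piecewise linear function with
  vertical error at most \<open>\<epsilon>\<close> from \<open>f\<close>.
\<close>

definition translatable_grid ::
  "(real \<times> real \<Rightarrow> real) \<Rightarrow> real \<Rightarrow> real \<Rightarrow> (real \<times> real) set set \<Rightarrow> bool" where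
  "translatable_grid f \<epsilon> D \<T> \<longleftrightarrow>
     triangular_grid \<T> \<and>
     (\<forall>T\<in>\<T>. \<forall>T'\<in>\<T>. congruent_sets T T') \<and>
     (\<forall>t. plane_triangulation (translate_triangles t \<T>) \<and>
          triangle_density (translate_triangles t \<T>) = ereal D \<and>
          (\<exists>h. piecewise_linear_wrt (translate_triangles t \<T>) h \<and>
               (\<forall>z. \<bar>f z - h z\<bar> \<le> \<epsilon>)))"

end

theory Submission
  imports Defs
begin

text \<open>
  Let \<open>q\<close> be the quadratic part of \<open>f\<close> and \<open>P = 8 * \<epsilon> / 3\<close>.  Since \<open>q\<close> is indefinite, some basis
  \<open>u, v\<close> of the plane satisfies
  \<open>q (x u + y v) = P * (x\<^sup>2 + 4 x y + y\<^sup>2) = P * (2 (x + y)\<^sup>2 - x\<^sup>2 - y\<^sup>2)\<close>.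
  The lines of the grid spanned by \<open>u\<close> and \<open>v\<close> are exactly those on which \<open>x\<close>, \<open>y\<close> or \<open>x + y\<close> is an
  integer.  So a function that is linear on the triangles arises by replacing each of the three
  squares by its one-variable piecewise linear interpolant at the integers, whose excess over the
  square is \<open>w s = frac s * (1 - frac s)\<close>.  The error of this replacement is \<open>P\<close> times
  \<open>2 * w (x + y) - w x - w y\<close>, which lies between \<open>- 1 / 2\<close> and \<open>1 / 4\<close>
  (\<open>frac_combination_bounds\<close>).  Raising all vertices by \<open>P / 8\<close> centres this range, and the
  error becomes at most \<open>3 * P / 8 = \<epsilon>\<close>.  The argument sees only the edge vectors, so the grid may be
  placed anywhere (\<open>translatable_grid_if_model_quadratic\<close>).

  The density of a triangulation by triangles of equal area and bounded diameter is the inverse of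
  that area (\<open>triangle_density_eq_inverse_area\<close>), because the triangles that meet a large square
  fill it and overhang it only by a bounded width.  The Gram determinant of \<open>q\<close> with respect to
  \<open>u, v\<close> gives \<open>(b\<^sup>2 - a c) * (cross u v)\<^sup>2 = 3 * P\<^sup>2\<close>, so the area is fixed by \<open>q\<close> and \<open>\<epsilon>\<close>.

  Finally, the basis is far from unique.  Along two null directions \<open>k1, k2\<close> of \<open>q\<close>, scaling by \<open>s\<close>
  and \<open>1 / s\<close> preserves \<open>q\<close> but changes Euclidean lengths.  If \<open>k1\<close> is at least as long as \<open>k2\<close>, then
  for \<open>s \<ge> 1\<close> all three edges of the grid triangles grow strictly with \<open>s\<close>
  (\<open>norm_hyperbolic_rotation_strict_mono\<close>), and the length of the longest edge tells the shapes apart.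
\<close>

section \<open>Area and density\<close>

definition cross :: "real \<times> real \<Rightarrow> real \<times> real \<Rightarrow> real" where
  "cross u v = fst u * snd v - snd u * fst v"

text \<open>Swapping \<^typ>\<open>real^2\<close> for \<^typ>\<open>real \<times> real\<close> preserves Lebesgue measure, which carries
  \<open>content_triangle\<close> over to the plane of pairs.\<close>

lemma lborel_plane_eq_distr:
  "distr lborel borel (\<lambda>z::real^2. (z $ 1, z $ 2)) = (lborel :: (real \<times> real) measure)"
proof (rule lborel_eqI[symmetric])
  fix l h :: "real \<times> real"
  assume le: "\<And>b. b \<in> Basis \<Longrightarrow> l \<bullet> b \<le> h \<bullet> b"
  have le': "fst l \<le> fst h" "snd l \<le> snd h"
    using le[of "(1, 0)"] le[of "(0, 1)"] by (auto simp: Basis_prod_def inner_prod_def)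
  let ?l = "vector [fst l, snd l] :: real^2" and ?h = "vector [fst h, snd h] :: real^2"
  have "(\<lambda>z::real^2. (z $ 1, z $ 2)) -` box l h = box ?l ?h"
    by (auto simp: mem_box_cart forall_2 mem_box Basis_prod_def inner_prod_def)
  moreover have "(\<lambda>z::real^2. (z $ 1, z $ 2)) \<in> borel_measurable lborel"
    by (intro borel_measurable_Pair) (auto intro: borel_measurable_nth)
  moreover have "(\<Prod>b\<in>Basis. (?h - ?l) \<bullet> b) = (fst h - fst l) * (snd h - snd l)"
    by (simp add: Basis_vec_def UNION_singleton_eq_range prod.reindex inj_on_def axis_eq_axis
        inner_axis prod_2 UNIV_2)
  moreover have "(\<Prod>b\<in>Basis. (h - l) \<bullet> b) = (fst h - fst l) * (snd h - snd l)"
    by (cases l; cases h) (simp add: Basis_prod_def prod.union_disjoint inner_prod_def)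
  moreover have "?l \<bullet> b \<le> ?h \<bullet> b" if "b \<in> Basis" for b
  proof -
    have "\<forall>i. ?l $ i \<le> ?h $ i" using le' by (simp add: forall_2)
    then show ?thesis using that by (auto simp: Basis_vec_def inner_axis)
  qed
  ultimately show "emeasure (distr lborel borel (\<lambda>z::real^2. (z $ 1, z $ 2))) (box l h) =
      (\<Prod>b\<in>Basis. (h - l) \<bullet> b)"
    by (subst emeasure_distr) auto
qed simp

lemma measure_triangle:
  fixes x y z :: "real \<times> real"
  shows "measure lebesgue (convex hull {x, y, z}) = \<bar>cross (y - x) (z - x)\<bar> / 2"
proof -
  let ?\<phi> = "\<lambda>z::real^2. (z $ 1, z $ 2)"
  define \<psi> where "\<psi> = (\<lambda>w::real \<times> real. vector [fst w, snd w] :: real^2)"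
  have lin: "linear \<psi>"
    by (rule linearI) (auto simp: \<psi>_def vec_eq_iff forall_2)
  have compact: "compact (convex hull {x, y, z})"
    by (intro finite_imp_compact_convex_hull) auto
  have vim: "?\<phi> -` S = \<psi> ` S" for S
    by (force simp: \<psi>_def image_iff vec_eq_iff forall_2)
  have "measure lebesgue (convex hull {x, y, z}) = measure (distr lborel borel ?\<phi>) (convex hull {x, y, z})"
    unfolding lborel_plane_eq_distr using compact by (intro measure_completion) (auto dest: borel_compact)
  also have "\<dots> = measure lborel (?\<phi> -` (convex hull {x, y, z}))"
    using borel_compact[OF compact] by (subst measure_distr) (auto intro!: borel_measurable_Pair borel_measurable_nth)
  also have "?\<phi> -` (convex hull {x, y, z}) = convex hull {\<psi> x, \<psi> y, \<psi> z}"
    unfolding vim by (simp add: convex_hull_linear_image[OF lin])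
  also have "measure lborel \<dots> = \<bar>cross (y - x) (z - x)\<bar> / 2"
    unfolding content_triangle
    by (simp add: \<psi>_def cross_def abs_minus_commute mult.commute)
  finally show ?thesis .
qed

lemma centered_square_measure:
  assumes "r \<ge> 0"
  shows "measure lebesgue (centered_square r) = r\<^sup>2" "centered_square r \<in> lmeasurable"
proof -
  have eq: "centered_square r = cbox (- r / 2, - r / 2) (r / 2, r / 2)"
    by (simp add: centered_square_def cbox_Pair_eq)
  show "measure lebesgue (centered_square r) = r\<^sup>2"
    unfolding eq using assms by (simp add: content_Pair power2_eq_square)
  show "centered_square r \<in> lmeasurable"
    unfolding eq by simp
qed

text \<open>If two convex sets differ, their intersection is a proper face of at least one of them, hence
  contained in its frontier, and the frontier of a convex set is a null set.\<close>

lemma negligible_Int_of_face_to_face: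
  fixes S T :: "'a::euclidean_space set"
  assumes "convex S" "convex T" "S \<inter> T face_of S" "S \<inter> T face_of T" "S \<noteq> T"
  shows "negligible (S \<inter> T)"
proof -
  have *: "negligible F" if "convex C" "F face_of C" "F \<noteq> C" for F C :: "'a set"
  proof (rule negligible_subset)
    show "negligible (frontier C)" using that by (intro negligible_convex_frontier)
    show "F \<subseteq> frontier C"
      using face_of_disjoint_interior[of F C] face_of_imp_subset[of F C] that closure_subset[of C]
      by (auto simp: frontier_def)
  qed
  show ?thesis
    using *[of S "S \<inter> T"] *[of T "S \<inter> T"] assms by blast
qed

text \<open>The triangles that meet the square of side \<open>r\<close> cover it and lie in the concentric square of side
  \<open>r + 2 * d\<close>.  As they overlap in null sets only, their number times \<open>A\<close> is between the areas of
  these squares, and both areas are \<open>r\<^sup>2\<close> to leading order.\<close>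

lemma triangle_density_eq_inverse_area:
  assumes tri: "plane_triangulation \<T>"
    and area: "\<And>T. T \<in> \<T> \<Longrightarrow> measure lebesgue T = A" and "A > 0"
    and diam: "\<And>T x y. T \<in> \<T> \<Longrightarrow> x \<in> T \<Longrightarrow> y \<in> T \<Longrightarrow> dist x y \<le> d"
  shows "triangle_density \<T> = ereal (1 / A)"
proof -
  define M where "M r = {T \<in> \<T>. T \<inter> centered_square r \<noteq> {}}" for r
  have simplex: "2 simplex T" if "T \<in> \<T>" for T
    using tri that by (auto simp: plane_triangulation_def)
  have cov: "\<Union>\<T> = UNIV" using tri by (auto simp: plane_triangulation_def)
  have meas: "T \<in> lmeasurable" if "T \<in> \<T>" for T
    using simplex[OF that] unfolding simplex_def
    by (auto intro!: lmeasurable_compact finite_imp_compact_convex_hull aff_independent_finite)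
  have negl: "negligible (S \<inter> T)" if "S \<in> \<T>" "T \<in> \<T>" "S \<noteq> T" for S T
    using tri that simplex[OF that(1)] simplex[OF that(2)]
    by (intro negligible_Int_of_face_to_face) (auto simp: plane_triangulation_def simplex_def)
  have d: "d \<ge> 0"
  proof -
    obtain T x where "T \<in> \<T>" "x \<in> T" using cov by blast
    from diam[OF this(1,2,2)] show ?thesis by simp
  qed
  have total: "measure lebesgue (\<Union>F) = card F * A" if "finite F" "F \<subseteq> \<T>" for F
  proof -
    have "measure lebesgue (\<Union>F) = (\<Sum>T\<in>F. measure lebesgue T)"
      using that meas negl by (intro measure_negligible_finite_Union) (auto simp: pairwise_def subset_eq)
    also have "\<dots> = card F * A" using that area by (simp add: subset_eq)
    finally show ?thesis .
  qed
  have upper: "card F * A \<le> (r + 2 * d)\<^sup>2" if "r > 0" "finite F" "F \<subseteq> M r" for F r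
  proof -
    have sub: "F \<subseteq> \<T>" using that by (auto simp: M_def)
    have "\<Union>F \<subseteq> centered_square (r + 2 * d)"
    proof
      fix y assume "y \<in> \<Union>F"
      then obtain T x where T: "T \<in> \<T>" "y \<in> T" "x \<in> T" "x \<in> centered_square r"
        using \<open>F \<subseteq> M r\<close> unfolding M_def by blast
      have "dist (fst x) (fst y) \<le> d" "dist (snd x) (snd y) \<le> d"
        using diam[OF T(1,3,2)] dist_fst_le[of x y] dist_snd_le[of x y] by linarith+
      then show "y \<in> centered_square (r + 2 * d)"
        using T(4) by (cases x; cases y) (auto simp: centered_square_def dist_real_def)
    qed
    then have "measure lebesgue (\<Union>F) \<le> measure lebesgue (centered_square (r + 2 * d))"
      using that d sub meas
      by (intro measure_mono_fmeasurable) (auto intro!: centered_square_measure fmeasurableD fmeasurable.finite_Union)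
    then show ?thesis
      using total[OF that(2) sub] that d by (simp add: centered_square_measure)
  qed
  \<comment> \<open>Finiteness has to come before the count, since \<^const>\<open>card\<close> is \<open>0\<close> on infinite sets; the area
      bound for finite subfamilies provides it.\<close>
  have fin: "finite (M r)" if "r > 0" for r
  proof (rule finite_if_finite_subsets_card_bdd[THEN conjunct1])
    fix F assume F: "F \<subseteq> M r" "finite F"
    have "real (card F) \<le> (r + 2 * d)\<^sup>2 / A"
      using upper[OF that F(2,1)] \<open>A > 0\<close> by (simp add: field_simps)
    then show "card F \<le> nat \<lceil>(r + 2 * d)\<^sup>2 / A\<rceil>" by linarith
  qed
  have lower: "r\<^sup>2 \<le> card (M r) * A" if "r > 0" for r
  proof -
    have sub: "M r \<subseteq> \<T>" by (auto simp: M_def)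
    have "centered_square r \<subseteq> \<Union>(M r)" using cov by (fastforce simp: M_def)
    then have "measure lebesgue (centered_square r) \<le> measure lebesgue (\<Union>(M r))"
      using that fin[OF that] sub meas
      by (intro measure_mono_fmeasurable) (auto intro!: centered_square_measure fmeasurableD fmeasurable.finite_Union)
    then show ?thesis
      using total[OF fin[OF that] sub] that by (simp add: centered_square_measure)
  qed
  have "((\<lambda>r. card (M r) / r\<^sup>2) \<longlongrightarrow> 1 / A) at_top"
  proof (rule tendsto_sandwich)
    show "\<forall>\<^sub>F r in at_top. 1 / A \<le> card (M r) / r\<^sup>2"
      using eventually_gt_at_top[of 0]
      by eventually_elim (use lower \<open>A > 0\<close> in \<open>simp add: field_simps\<close>)
    show "\<forall>\<^sub>F r in at_top. card (M r) / r\<^sup>2 \<le> (1 + 2 * d * inverse r)\<^sup>2 / A"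
      using eventually_gt_at_top[of 0]
    proof eventually_elim
      fix r :: real assume r: "0 < r"
      have "(1 + 2 * d * inverse r)\<^sup>2 = (r + 2 * d)\<^sup>2 / r\<^sup>2"
        using r by (simp add: field_simps power2_eq_square)
      then show "card (M r) / r\<^sup>2 \<le> (1 + 2 * d * inverse r)\<^sup>2 / A"
        using upper[OF r fin[OF r]] r \<open>A > 0\<close> by (simp add: field_simps)
    qed
    have "((\<lambda>r::real. (1 + 2 * d * inverse r)\<^sup>2 / A) \<longlongrightarrow> (1 + 2 * d * 0)\<^sup>2 / A) at_top"
      using \<open>A > 0\<close> by (intro tendsto_intros tendsto_inverse_0_at_top filterlim_ident) auto
    then show "((\<lambda>r::real. (1 + 2 * d * inverse r)\<^sup>2 / A) \<longlongrightarrow> 1 / A) at_top" by simp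
  qed auto
  then have "((\<lambda>r. ereal (card (M r) / r\<^sup>2)) \<longlongrightarrow> ereal (1 / A)) at_top"
    by simp
  from lim_imp_Limsup[OF _ this] show ?thesis
    by (simp add: triangle_density_def M_def)
qed

section \<open>Triangular grids as triangulations\<close>

text \<open>The closed strip between two adjacent members of a family of parallel lines with normal \<open>n\<close>.  A
  grid triangle is an intersection of three strips, one from each of the three families of grid lines.\<close>

definition strip :: "'a::real_inner \<Rightarrow> real \<Rightarrow> int \<Rightarrow> 'a set" where
  "strip n \<alpha> k = {z. \<alpha> + of_int k \<le> n \<bullet> z \<and> n \<bullet> z \<le> \<alpha> + of_int k + 1}"

lemma convex_strip: "convex (strip n \<alpha> k)"
proof -
  have "strip n \<alpha> k = {z. n \<bullet> z \<ge> \<alpha> + of_int k} \<inter> {z. n \<bullet> z \<le> \<alpha> + of_int k + 1}"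
    by (auto simp: strip_def)
  then show ?thesis
    by (simp add: convex_Int convex_halfspace_ge convex_halfspace_le)
qed

text \<open>This is what makes grids face-to-face: within one family, two strips coincide, share a boundary
  line, or are disjoint, and faces are preserved by intersecting with the strips of the other families.\<close>

lemma strip_Int_face_of: "strip n \<alpha> k \<inter> strip n \<alpha> l face_of strip n \<alpha> k"
proof -
  consider "l = k" | "l = k + 1" | "l = k - 1" | "l \<ge> k + 2" | "l \<le> k - 2" by linarith
  then show ?thesis
  proof cases
    case 1
    then show ?thesis by (simp add: convex_strip face_of_refl)
  next
    case 2
    then have "strip n \<alpha> k \<inter> strip n \<alpha> l = strip n \<alpha> k \<inter> {z. n \<bullet> z = \<alpha> + of_int k + 1}"
      by (auto simp: strip_def)
    then show ?thesis
      using face_of_Int_supporting_hyperplane_le[OF convex_strip, of n \<alpha> k n "\<alpha> + of_int k + 1"]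
      by (simp add: strip_def)
  next
    case 3
    then have "strip n \<alpha> k \<inter> strip n \<alpha> l = strip n \<alpha> k \<inter> {z. n \<bullet> z = \<alpha> + of_int k}"
      by (auto simp: strip_def)
    then show ?thesis
      using face_of_Int_supporting_hyperplane_ge[OF convex_strip, of n \<alpha> k "\<alpha> + of_int k" n]
      by (simp add: strip_def)
  next
    case 4
    then have "(of_int l :: real) \<ge> of_int k + 2" by linarith
    then have "strip n \<alpha> k \<inter> strip n \<alpha> l = {}" by (auto simp: strip_def)
    then show ?thesis by simp
  next
    case 5
    then have "(of_int l :: real) \<le> of_int k - 2" by linarith
    then have "strip n \<alpha> k \<inter> strip n \<alpha> l = {}" by (auto simp: strip_def)
    then show ?thesis by simp
  qed
qed

lemma independent_if_cross_nonzero: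
  assumes "cross u v \<noteq> 0"
  shows "u \<noteq> v" "independent {u, v}"
proof -
  show "u \<noteq> v" using assms by (auto simp: cross_def)
  have "v \<noteq> 0" using assms by (auto simp: cross_def)
  have "u \<notin> span {v}"
    using assms by (auto simp: span_singleton cross_def)
  then show "independent {u, v}"
    using \<open>v \<noteq> 0\<close> by (simp add: independent_insert)
qed

lemma simplex_triangle:
  assumes "cross (y - x) (z - x) \<noteq> 0"
  shows "2 simplex (convex hull {x, y, z})"
proof -
  have ne: "x \<noteq> y" "x \<noteq> z" "y \<noteq> z" using assms by (auto simp: cross_def)
  have "\<not> affine_dependent {x, y, z}"
    using independent_if_cross_nonzero[OF assms] ne
    by (subst affine_dependent_iff_dependent) (auto simp: )
  moreover have "card {x, y, z} = 3" using ne by simp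
  ultimately show ?thesis unfolding simplex_def by (intro exI[of _ "{x,y,z}"]) auto
qed

text \<open>The functionals \<open>dual_u\<close> and \<open>dual_v\<close> below read off the coordinates with respect to \<open>u\<close> and \<open>v\<close>.\<close>

locale plane_basis =
  fixes u v :: "real \<times> real"
  assumes cross_nonzero: "cross u v \<noteq> 0"
begin

definition dual_u :: "real \<times> real" where
  "dual_u = (snd v / cross u v, - fst v / cross u v)"

definition dual_v :: "real \<times> real" where
  "dual_v = (- snd u / cross u v, fst u / cross u v)"

lemma inner_dual:
  "dual_u \<bullet> z = cross z v / cross u v" "dual_v \<bullet> z = cross u z / cross u v"
  by (simp_all add: dual_u_def dual_v_def inner_prod_def cross_def diff_divide_distrib mult.commute)

lemma dual_simps [simp]:
  "dual_u \<bullet> u = 1" "dual_u \<bullet> v = 0" "dual_v \<bullet> u = 0" "dual_v \<bullet> v = 1"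
  using cross_nonzero by (simp_all add: inner_dual) (simp_all add: cross_def)

lemma dual_expand: "z = (dual_u \<bullet> z) *\<^sub>R u + (dual_v \<bullet> z) *\<^sub>R v"
proof -
  have "cross u v * fst z = cross z v * fst u + cross u z * fst v"
       "cross u v * snd z = cross z v * snd u + cross u z * snd v"
    by (simp_all add: cross_def algebra_simps)
  then show ?thesis
    using cross_nonzero by (intro prod_eqI) (simp_all add: inner_dual field_simps)
qed

text \<open>In coordinates relative to \<open>p\<close>, the cell is \<open>i \<le> x \<le> i + 1\<close>, \<open>j \<le> y \<le> j + 1\<close>, \<open>k \<le> x + y \<le> k + 1\<close>.
  The parallelogram of the first two conditions is cut by the line \<open>x + y = i + j + 1\<close>, so the
  cell is a triangle exactly for \<open>k = i + j\<close> and \<open>k = i + j + 1\<close>.\<close>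

definition cell :: "real \<times> real \<Rightarrow> int \<Rightarrow> int \<Rightarrow> int \<Rightarrow> (real \<times> real) set" where
  "cell p i j k = strip dual_u (dual_u \<bullet> p) i \<inter> strip dual_v (dual_v \<bullet> p) j \<inter>
     strip (dual_u + dual_v) ((dual_u + dual_v) \<bullet> p) k"

lemma mem_cell_iff:
  "p + x *\<^sub>R u + y *\<^sub>R v \<in> cell p i j k \<longleftrightarrow>
     of_int i \<le> x \<and> x \<le> of_int i + 1 \<and> of_int j \<le> y \<and> y \<le> of_int j + 1 \<and>
     of_int k \<le> x + y \<and> x + y \<le> of_int k + 1"
  by (auto simp: cell_def strip_def inner_add_right inner_add_left)

lemma in_coordinates: obtains x y where "z = p + x *\<^sub>R u + y *\<^sub>R v"
  using dual_expand[of "z - p"] by (metis add.commute diff_add_cancel add.assoc)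

lemma coordinates_unique:
  "p + x *\<^sub>R u + y *\<^sub>R v = p + x' *\<^sub>R u + y' *\<^sub>R v \<longleftrightarrow> x = x' \<and> y = y'"
proof
  assume "p + x *\<^sub>R u + y *\<^sub>R v = p + x' *\<^sub>R u + y' *\<^sub>R v"
  then have eq: "x *\<^sub>R u + y *\<^sub>R v = x' *\<^sub>R u + y' *\<^sub>R v" by (simp add: add.assoc)
  show "x = x' \<and> y = y'"
    using arg_cong[OF eq, of "\<lambda>z. dual_u \<bullet> z"] arg_cong[OF eq, of "\<lambda>z. dual_v \<bullet> z"]
    by (simp add: inner_add_right)
qed auto

lemma lower_triangle_eq_cell:
  "(+) (p + of_int i *\<^sub>R u + of_int j *\<^sub>R v) ` (convex hull {0, u, v}) = cell p i j (i + j)"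
proof (rule set_eqI)
  fix z
  obtain x y where z: "z = p + x *\<^sub>R u + y *\<^sub>R v" by (rule in_coordinates)
  have "z \<in> (+) (p + of_int i *\<^sub>R u + of_int j *\<^sub>R v) ` (convex hull {0, u, v}) \<longleftrightarrow>
     (\<exists>r s t. 0 \<le> r \<and> 0 \<le> s \<and> 0 \<le> t \<and> r + s + t = 1 \<and>
        z = p + (of_int i + s) *\<^sub>R u + (of_int j + t) *\<^sub>R v)"
    unfolding convex_hull_3 image_iff by (fastforce simp: algebra_simps)
  also have "\<dots> \<longleftrightarrow> z \<in> cell p i j (i + j)"
    unfolding z mem_cell_iff coordinates_unique
  proof (rule iffI, goal_cases)
    case 1 then show ?case by auto
  next
    case 2 show ?case
      by (rule exI[where x = "1 - (x - of_int i) - (y - of_int j)"], rule exI[where x = "x - of_int i"],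
          rule exI[where x = "y - of_int j"], use 2 in auto)
  qed
  finally show "z \<in> (+) (p + of_int i *\<^sub>R u + of_int j *\<^sub>R v) ` (convex hull {0, u, v}) \<longleftrightarrow>
      z \<in> cell p i j (i + j)" .
qed

lemma upper_triangle_eq_cell:
  "(+) (p + of_int i *\<^sub>R u + of_int j *\<^sub>R v) ` (convex hull {u, v, u + v}) = cell p i j (i + j + 1)"
proof (rule set_eqI)
  fix z
  obtain x y where z: "z = p + x *\<^sub>R u + y *\<^sub>R v" by (rule in_coordinates)
  have "z \<in> (+) (p + of_int i *\<^sub>R u + of_int j *\<^sub>R v) ` (convex hull {u, v, u + v}) \<longleftrightarrow>
     (\<exists>r s t. 0 \<le> r \<and> 0 \<le> s \<and> 0 \<le> t \<and> r + s + t = 1 \<and>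
        z = p + (of_int i + (r + t)) *\<^sub>R u + (of_int j + (s + t)) *\<^sub>R v)"
    unfolding convex_hull_3 image_iff by (fastforce simp: algebra_simps)
  also have "\<dots> \<longleftrightarrow> z \<in> cell p i j (i + j + 1)"
    unfolding z mem_cell_iff coordinates_unique
  proof (rule iffI, goal_cases)
    case 1 then show ?case by auto
  next
    case 2 show ?case
      by (rule exI[where x = "1 - (y - of_int j)"], rule exI[where x = "1 - (x - of_int i)"],
          rule exI[where x = "(x - of_int i) + (y - of_int j) - 1"], use 2 in auto)
  qed
  finally show "z \<in> (+) (p + of_int i *\<^sub>R u + of_int j *\<^sub>R v) ` (convex hull {u, v, u + v}) \<longleftrightarrow>
      z \<in> cell p i j (i + j + 1)" .
qed

lemma grid_triangles_eq_cells:
  "grid_triangles p u v = (\<Union>i j. {cell p i j (i + j), cell p i j (i + j + 1)})"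
  unfolding grid_triangles_def lower_triangle_eq_cell upper_triangle_eq_cell ..

lemma grid_triangle_is_cell: "T \<in> grid_triangles p u v \<Longrightarrow> \<exists>i j k. T = cell p i j k"
  unfolding grid_triangles_eq_cells by blast

lemma cell_Int_face_of: "cell p i j k \<inter> cell p i' j' k' face_of cell p i j k"
proof -
  have "cell p i j k \<inter> cell p i' j' k' =
     (strip dual_u (dual_u \<bullet> p) i \<inter> strip dual_u (dual_u \<bullet> p) i') \<inter>
     (strip dual_v (dual_v \<bullet> p) j \<inter> strip dual_v (dual_v \<bullet> p) j') \<inter>
     (strip (dual_u + dual_v) ((dual_u + dual_v) \<bullet> p) k \<inter> strip (dual_u + dual_v) ((dual_u + dual_v) \<bullet> p) k')"
    by (auto simp: cell_def)
  then show ?thesis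
    unfolding cell_def by (auto intro!: face_of_Int_Int strip_Int_face_of)
qed

lemma grid_triangle_vertices:
  assumes "T \<in> grid_triangles p u v"
  obtains w where "T = convex hull {w, w + u, w + v} \<or> T = convex hull {w + u, w + v, w + (u + v)}"
proof -
  obtain w where "T = (+) w ` (convex hull {0, u, v}) \<or> T = (+) w ` (convex hull {u, v, u + v})"
    using assms unfolding grid_triangles_def by blast
  then show ?thesis by (intro that[of w]) (auto simp: convex_hull_translation[symmetric])
qed

lemma simplex_grid_triangle:
  assumes "T \<in> grid_triangles p u v"
  shows "2 simplex T"
proof -
  have "2 simplex (convex hull {w, w + u, w + v})"
    "2 simplex (convex hull {w + u, w + v, w + (u + v)})" for w
    using cross_nonzero by (auto intro!: simplex_triangle simp: cross_def algebra_simps)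
  with grid_triangle_vertices[OF assms] show ?thesis by metis
qed

lemma UNION_grid_triangles: "\<Union>(grid_triangles p u v) = UNIV"
proof -
  have "z \<in> \<Union>(grid_triangles p u v)" for z
  proof -
    obtain x y where z: "z = p + x *\<^sub>R u + y *\<^sub>R v" by (rule in_coordinates)
    have "z \<in> cell p \<lfloor>x\<rfloor> \<lfloor>y\<rfloor> (\<lfloor>x\<rfloor> + \<lfloor>y\<rfloor>) \<or> z \<in> cell p \<lfloor>x\<rfloor> \<lfloor>y\<rfloor> (\<lfloor>x\<rfloor> + \<lfloor>y\<rfloor> + 1)"
      unfolding z mem_cell_iff by (auto; linarith)
    then show ?thesis unfolding grid_triangles_eq_cells by blast
  qed
  then show ?thesis by blast
qed

text \<open>The coordinates are bounded on a ball, and the indices of a cell that meets the ball differ by at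
  most \<open>1\<close> from coordinates of a point in it.\<close>

lemma finite_grid_triangles_meeting_ball:
  "finite {T \<in> grid_triangles p u v. T \<inter> ball z0 1 \<noteq> {}}"
proof -
  obtain N where N: "\<And>z. z \<in> ball z0 1 \<Longrightarrow> \<bar>dual_u \<bullet> (z - p)\<bar> \<le> of_int N \<and> \<bar>dual_v \<bullet> (z - p)\<bar> \<le> of_int N"
  proof -
    let ?R = "(norm dual_u + norm dual_v) * (1 + norm (z0 - p))"
    have "\<bar>n \<bullet> (z - p)\<bar> \<le> of_int \<lceil>?R\<rceil>"
      if "z \<in> ball z0 1" "n = dual_u \<or> n = dual_v" for z n
    proof -
      have "norm (z - p) \<le> norm (z - z0) + norm (z0 - p)"
        using norm_triangle_ineq[of "z - z0" "z0 - p"] by simp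
      then have "norm (z - p) \<le> 1 + norm (z0 - p)"
        using that by (simp add: dist_norm norm_minus_commute)
      then have "norm n * norm (z - p) \<le> ?R"
        using that by (intro mult_mono) auto
      with Cauchy_Schwarz_ineq2[of n "z - p"] show ?thesis by linarith
    qed
    then show ?thesis by (intro that[of "\<lceil>?R\<rceil>"]) auto
  qed
  have "{T \<in> grid_triangles p u v. T \<inter> ball z0 1 \<noteq> {}} \<subseteq>
      (\<Union>i\<in>{-N-1..N}. \<Union>j\<in>{-N-1..N}. {cell p i j (i + j), cell p i j (i + j + 1)})"
  proof
    fix T assume "T \<in> {T \<in> grid_triangles p u v. T \<inter> ball z0 1 \<noteq> {}}"
    then obtain i j z where T: "T \<in> {cell p i j (i + j), cell p i j (i + j + 1)}"
      and z: "z \<in> T" "z \<in> ball z0 1"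
      unfolding grid_triangles_eq_cells by blast
    obtain x y where xy: "z = p + x *\<^sub>R u + y *\<^sub>R v" by (rule in_coordinates)
    have "of_int i \<le> x" "x \<le> of_int i + 1" "of_int j \<le> y" "y \<le> of_int j + 1"
      using T z(1) unfolding xy by (auto simp: mem_cell_iff)
    moreover have "\<bar>x\<bar> \<le> of_int N" "\<bar>y\<bar> \<le> of_int N"
      using N[OF z(2)] unfolding xy by (auto simp: inner_add_right)
    ultimately have "i \<in> {-N-1..N}" "j \<in> {-N-1..N}" by (auto; linarith)+
    then show "T \<in> (\<Union>i\<in>{-N-1..N}. \<Union>j\<in>{-N-1..N}. {cell p i j (i + j), cell p i j (i + j + 1)})"
      using T by blast
  qed
  then show ?thesis by (rule finite_subset) auto
qed

lemma plane_triangulation_grid: "plane_triangulation (grid_triangles p u v)"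
proof -
  have "T \<inter> T' face_of T \<and> T \<inter> T' face_of T'"
    if T: "T \<in> grid_triangles p u v" and T': "T' \<in> grid_triangles p u v" for T T'
  proof -
    obtain i j k i' j' k' where "T = cell p i j k" "T' = cell p i' j' k'"
      using grid_triangle_is_cell[OF T] grid_triangle_is_cell[OF T'] by metis
    then show ?thesis by (metis cell_Int_face_of inf_commute)
  qed
  moreover have "locally_finite_in euclidean (grid_triangles p u v)"
    unfolding locally_finite_in_def
  proof (intro conjI ballI)
    fix z :: "real \<times> real"
    show "\<exists>V. openin euclidean V \<and> z \<in> V \<and> finite {T \<in> grid_triangles p u v. T \<inter> V \<noteq> {}}"
      using finite_grid_triangles_meeting_ball[of p z] by (intro exI[of _ "ball z 1"]) simp
  qed simp
  ultimately show ?thesis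
    by (auto simp: plane_triangulation_def UNION_grid_triangles simplex_grid_triangle)
qed

end

section \<open>Piecewise linear interpolation of squares\<close>

text \<open>The piecewise linear interpolant of \<open>x\<^sup>2\<close> at the integers: on \<open>[n, n + 1]\<close> it is the chord through
  \<open>(n, n\<^sup>2)\<close> and \<open>(n + 1, (n + 1)\<^sup>2)\<close>.\<close>

definition square_interpolant :: "real \<Rightarrow> real" where
  "square_interpolant x = (2 * of_int \<lfloor>x\<rfloor> + 1) * x - of_int \<lfloor>x\<rfloor> * (of_int \<lfloor>x\<rfloor> + 1)"

lemma square_interpolant_eq_add_frac:
  "square_interpolant x = x\<^sup>2 + frac x * (1 - frac x)"
  by (simp add: square_interpolant_def frac_def algebra_simps power2_eq_square)

lemma square_interpolant_on_unit_interval: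
  assumes "of_int i \<le> x" "x \<le> of_int i + 1"
  shows "square_interpolant x = (2 * of_int i + 1) * x - of_int i * (of_int i + 1)"
proof (cases "x = of_int i + 1")
  case True
  then have "\<lfloor>x\<rfloor> = i + 1" by linarith
  then show ?thesis using True by (simp add: square_interpolant_def algebra_simps)
next
  case False
  then have "\<lfloor>x\<rfloor> = i" using assms by linarith
  then show ?thesis by (simp add: square_interpolant_def)
qed

text \<open>The extended chords support the interpolant from below.  It is therefore convex, from which its
  continuity follows without any gluing at the integers.\<close>

lemma square_interpolant_ge_chord:
  "(2 * of_int n + 1) * x - of_int n * (of_int n + 1) \<le> square_interpolant x"
proof -
  let ?k = "of_int (\<lfloor>x\<rfloor> - n) :: real"
  have "square_interpolant x - ((2 * of_int n + 1) * x - of_int n * (of_int n + 1)) =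
      ?k * (?k - 1 + 2 * frac x)"
    by (simp add: square_interpolant_def frac_def algebra_simps)
  moreover have "?k * (?k - 1 + 2 * frac x) \<ge> 0"
  proof -
    consider "\<lfloor>x\<rfloor> - n = 0" | "\<lfloor>x\<rfloor> - n \<ge> 1" | "\<lfloor>x\<rfloor> - n \<le> - 1" by linarith
    then show ?thesis
    proof cases
      case 2
      then have "?k \<ge> 1" by linarith
      then show ?thesis using frac_ge_0[of x] by (intro mult_nonneg_nonneg) auto
    next
      case 3
      then have "?k \<le> - 1" by linarith
      then show ?thesis using frac_lt_1[of x] by (intro mult_nonpos_nonpos) auto
    qed simp
  qed
  ultimately show ?thesis by linarith
qed

lemma continuous_on_square_interpolant: "continuous_on UNIV square_interpolant"
proof (rule convex_on_continuous)
  show "convex_on UNIV square_interpolant"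
  proof (rule convex_onI)
    fix t x y :: real assume t: "0 < t" "t < 1"
    let ?z = "(1 - t) *\<^sub>R x + t *\<^sub>R y"
    define n where "n = \<lfloor>?z\<rfloor>"
    have "square_interpolant ?z = (1 - t) * ((2 * of_int n + 1) * x - of_int n * (of_int n + 1)) +
        t * ((2 * of_int n + 1) * y - of_int n * (of_int n + 1))"
      unfolding square_interpolant_def n_def[symmetric] by (simp add: algebra_simps)
    also have "\<dots> \<le> (1 - t) * square_interpolant x + t * square_interpolant y"
      using t by (intro add_mono mult_left_mono square_interpolant_ge_chord) auto
    finally show "square_interpolant ?z \<le> (1 - t) * square_interpolant x + t * square_interpolant y" .
  qed simp
qed simp

text \<open>For the upper bound let \<open>s, t\<close> be the fractional parts of \<open>x\<close> and \<open>y\<close>.  If \<open>s + t < 1\<close>, the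
  combination is \<open>1 / 4 - (s + t - 1 / 2)\<^sup>2 - 2 * s * t\<close>.  Otherwise the point reflection
  \<open>(s, t) \<mapsto> (1 - s, 1 - t)\<close>, which exchanges the two triangles of the unit square and preserves \<open>w\<close>,
  leads back to the same formula.  The lower bound only uses \<open>0 \<le> w \<le> 1 / 4\<close>.\<close>

lemma frac_combination_bounds:
  fixes x y :: real
  defines "w \<equiv> \<lambda>x::real. frac x * (1 - frac x)"
  shows "- 1 / 2 \<le> 2 * w (x + y) - w x - w y" "2 * w (x + y) - w x - w y \<le> 1 / 4"
proof -
  have nonneg: "0 \<le> w x" for x
    using frac_ge_0[of x] frac_lt_1[of x] by (simp add: w_def)
  have "w x \<le> 1 / 4" for x
    using zero_le_power2[of "frac x - 1 / 2"] by (simp add: w_def power2_eq_square algebra_simps)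
  from this[of x] this[of y] nonneg[of "x + y"] show "- 1 / 2 \<le> 2 * w (x + y) - w x - w y"
    by linarith
  have key: "2 * ((s + t) * (1 - (s + t))) - s * (1 - s) - t * (1 - t) \<le> 1 / 4"
    if "s \<ge> 0" "t \<ge> 0" for s t :: real
  proof -
    have "1 / 4 - (2 * ((s + t) * (1 - (s + t))) - s * (1 - s) - t * (1 - t)) =
        (s + t - 1 / 2)\<^sup>2 + 2 * (s * t)"
      by (simp add: power2_eq_square algebra_simps)
    also have "\<dots> \<ge> 0" using that by simp
    finally show ?thesis by simp
  qed
  show "2 * w (x + y) - w x - w y \<le> 1 / 4"
  proof (cases "frac x + frac y < 1")
    case True
    then show ?thesis
      using key[of "frac x" "frac y"] by (simp add: w_def frac_add)
  next
    case False
    have "0 \<le> 1 - frac x" "0 \<le> 1 - frac y"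
      using frac_lt_1[of x] frac_lt_1[of y] by linarith+
    from key[OF this] False show ?thesis
      by (simp add: w_def frac_add algebra_simps)
  qed
qed

section \<open>Congruence of grid triangles\<close>

lemma translate_grid_triangles:
  "translate_triangles t (grid_triangles p u v) = grid_triangles (t + p) u v"
  by (simp add: translate_triangles_def grid_triangles_def image_UN image_image add.assoc)

text \<open>The triangle \<open>{u, v, u + v}\<close> is the point reflection of \<open>{0, u, v}\<close> in \<open>(u + v) / 2\<close>, so the sign
  \<open>\<sigma>\<close> tells the two kinds of grid triangles apart.\<close>

lemma grid_triangle_isometric_copy:
  assumes "T \<in> grid_triangles p u v"
  obtains w \<sigma> where "\<sigma> = 1 \<or> \<sigma> = - 1" "T = (\<lambda>z. w + \<sigma> *\<^sub>R z) ` (convex hull {0, u, v})"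
proof -
  have "convex hull {u, v, u + v} = (\<lambda>z. (u + v) + (- 1) *\<^sub>R z) ` (convex hull {0, u, v})"
  proof -
    have "(\<lambda>z. (u + v) + (- 1) *\<^sub>R z) ` (convex hull {0, u, v}) =
        (+) (u + v) ` ((\<lambda>z. (- 1) *\<^sub>R z) ` (convex hull {0, u, v}))"
      by (simp add: image_image)
    also have "(\<lambda>z. (- 1) *\<^sub>R z) ` (convex hull {0, u, v}) = convex hull {0, - u, - v}"
      by (subst convex_hull_linear_image) (auto simp: linear_iff)
    finally show ?thesis
      by (simp add: convex_hull_translation[symmetric] insert_commute)
  qed
  then have *: "(+) w ` (convex hull {u, v, u + v}) = (\<lambda>z. (w + (u + v)) + (- 1) *\<^sub>R z) ` (convex hull {0, u, v})" for w
    by (simp add: image_image add_diff_eq)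
  obtain w where "T = (+) w ` (convex hull {0, u, v}) \<or> T = (+) w ` (convex hull {u, v, u + v})"
    using assms unfolding grid_triangles_def by blast
  then show ?thesis
  proof
    assume "T = (+) w ` (convex hull {0, u, v})"
    then show ?thesis by (intro that[of 1 w]) simp_all
  next
    assume "T = (+) w ` (convex hull {u, v, u + v})"
    then show ?thesis unfolding * by (intro that[of "-1" "w + (u + v)"]) simp_all
  qed
qed

lemma dist_reflect_translate:
  fixes x y w :: "'a::real_normed_vector"
  assumes "\<sigma> = 1 \<or> \<sigma> = - 1"
  shows "dist (w + \<sigma> *\<^sub>R x) (w + \<sigma> *\<^sub>R y) = dist x y"
proof -
  have "dist (w + \<sigma> *\<^sub>R x) (w + \<sigma> *\<^sub>R y) = norm (\<sigma> *\<^sub>R (x - y))"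
    by (simp add: dist_norm scaleR_right_diff_distrib)
  also have "\<dots> = dist x y" using assms unfolding norm_scaleR by (auto simp: dist_norm)
  finally show ?thesis .
qed

lemma grid_triangles_congruent:
  assumes "T \<in> grid_triangles p u v" "T' \<in> grid_triangles p' u v"
  shows "congruent_sets T T'"
proof -
  obtain w \<sigma> where T: "\<sigma> = 1 \<or> \<sigma> = - 1" "T = (\<lambda>z. w + \<sigma> *\<^sub>R z) ` (convex hull {0, u, v})"
    by (rule grid_triangle_isometric_copy[OF assms(1)])
  obtain w' \<sigma>' where T': "\<sigma>' = 1 \<or> \<sigma>' = - 1" "T' = (\<lambda>z. w' + \<sigma>' *\<^sub>R z) ` (convex hull {0, u, v})"
    by (rule grid_triangle_isometric_copy[OF assms(2)])
  let ?h = "\<lambda>z. (w' - (\<sigma>' * \<sigma>) *\<^sub>R w) + (\<sigma>' * \<sigma>) *\<^sub>R z"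
  have iso: "dist (?h x) (?h y) = dist x y" for x y
    using T(1) T'(1) by (intro dist_reflect_translate) auto
  have h_copy: "?h (w + \<sigma> *\<^sub>R z) = w' + \<sigma>' *\<^sub>R z" for z
    using T(1) by (elim disjE) (simp_all add: scaleR_right_distrib scaleR_right_diff_distrib)
  have onto: "?h ` T = T'"
    unfolding T(2) T'(2) image_image by (intro image_cong refl h_copy)
  show ?thesis
    unfolding congruent_sets_def by (intro exI[of _ ?h] conjI allI iso onto)
qed

text \<open>The diameter of the grid triangles, which is the congruence invariant used to distinguish grids.\<close>

definition longest_edge :: "real \<times> real \<Rightarrow> real \<times> real \<Rightarrow> real" where
  "longest_edge u v = max (norm u) (max (norm v) (norm (u - v)))"

lemma grid_triangle_dist_le_longest_edge:
  assumes "T \<in> grid_triangles p u v" "x \<in> T" "y \<in> T"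
  shows "dist x y \<le> longest_edge u v"
proof -
  obtain w \<sigma> where T: "\<sigma> = 1 \<or> \<sigma> = - 1" "T = (\<lambda>z. w + \<sigma> *\<^sub>R z) ` (convex hull {0, u, v})"
    by (rule grid_triangle_isometric_copy[OF assms(1)])
  obtain x' where x': "x = w + \<sigma> *\<^sub>R x'" "x' \<in> convex hull {0, u, v}"
    using assms(2) unfolding T(2) by (rule imageE)
  obtain y' where y': "y = w + \<sigma> *\<^sub>R y'" "y' \<in> convex hull {0, u, v}"
    using assms(3) unfolding T(2) by (rule imageE)
  have "\<exists>a\<in>{0, u, v}. \<exists>b\<in>{0, u, v}. \<forall>x\<in>convex hull {0, u, v}. \<forall>y\<in>convex hull {0, u, v}.
      norm (x - y) \<le> norm (a - b)"
    by (rule simplex_extremal_le) auto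
  then obtain a b where ab: "a \<in> {0, u, v}" "b \<in> {0, u, v}" "dist x' y' \<le> norm (a - b)"
    using x'(2) y'(2) unfolding dist_norm by blast
  have "norm (a - b) \<le> longest_edge u v"
    using ab(1,2) norm_minus_commute[of u v] by (auto simp: longest_edge_def le_max_iff_disj)
  with ab(3) show ?thesis
    unfolding x'(1) y'(1) dist_reflect_translate[OF T(1)] by (rule order_trans)
qed

lemma grid_triangle_attains_longest_edge:
  assumes "T \<in> grid_triangles p u v"
  obtains x y where "x \<in> T" "y \<in> T" "dist x y = longest_edge u v"
proof -
  obtain w \<sigma> where T: "\<sigma> = 1 \<or> \<sigma> = - 1" "T = (\<lambda>z. w + \<sigma> *\<^sub>R z) ` (convex hull {0, u, v})"
    by (rule grid_triangle_isometric_copy[OF assms])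
  have hull: "{0, u, v} \<subseteq> convex hull {0, u, v}" by (rule hull_subset)
  have "longest_edge u v = dist u 0 \<or> longest_edge u v = dist v 0 \<or> longest_edge u v = dist u v"
    by (auto simp: longest_edge_def dist_norm max_def)
  then obtain x y where xy: "x \<in> {0, u, v}" "y \<in> {0, u, v}" "dist x y = longest_edge u v"
    by (metis insertCI)
  show ?thesis
  proof (rule that)
    show "w + \<sigma> *\<^sub>R x \<in> T" "w + \<sigma> *\<^sub>R y \<in> T"
      unfolding T(2) using xy(1,2) hull by blast+
    show "dist (w + \<sigma> *\<^sub>R x) (w + \<sigma> *\<^sub>R y) = longest_edge u v"
      unfolding dist_reflect_translate[OF T(1)] by (rule xy(3))
  qed
qed

lemma congruent_grid_triangles_longest_edge:
  assumes "T \<in> grid_triangles p u v" "T' \<in> grid_triangles p' u' v'" "congruent_sets T T'"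
  shows "longest_edge u v = longest_edge u' v'"
proof (rule antisym)
  obtain h where h: "\<And>x y. dist (h x) (h y) = dist x y" "h ` T = T'"
    using assms(3) by (auto simp: congruent_sets_def)
  obtain x y where "x \<in> T" "y \<in> T" "dist x y = longest_edge u v"
    by (rule grid_triangle_attains_longest_edge[OF assms(1)])
  then show "longest_edge u v \<le> longest_edge u' v'"
    using grid_triangle_dist_le_longest_edge[OF assms(2), of "h x" "h y"] h by auto
  obtain x' y' where "x' \<in> T'" "y' \<in> T'" "dist x' y' = longest_edge u' v'"
    by (rule grid_triangle_attains_longest_edge[OF assms(2)])
  then show "longest_edge u' v' \<le> longest_edge u v"
    using grid_triangle_dist_le_longest_edge[OF assms(1)] h by force
qed

section \<open>The approximating function on a grid\<close>

lemma (in plane_basis) grid_triangle_measure: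
  assumes "T \<in> grid_triangles p u v"
  shows "measure lebesgue T = \<bar>cross u v\<bar> / 2"
proof -
  have "cross (v - u) ((u + v) - u) = - cross u v"
    by (simp add: cross_def algebra_simps)
  then have "measure lebesgue (convex hull {w, w + u, w + v}) = \<bar>cross u v\<bar> / 2"
      "measure lebesgue (convex hull {w + u, w + v, w + (u + v)}) = \<bar>cross u v\<bar> / 2" for w
    unfolding measure_triangle by simp_all
  moreover obtain w where "T = convex hull {w, w + u, w + v} \<or> T = convex hull {w + u, w + v, w + (u + v)}"
    by (rule grid_triangle_vertices[OF assms])
  ultimately show ?thesis by presburger
qed

lemma (in plane_basis) triangle_density_grid:
  "triangle_density (grid_triangles p u v) = ereal (2 / \<bar>cross u v\<bar>)"
  using triangle_density_eq_inverse_area[OF plane_triangulation_grid grid_triangle_measure _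
      grid_triangle_dist_le_longest_edge] cross_nonzero
  by simp

text \<open>The vertex values are those of \<open>f\<close>, raised by \<open>P / 8\<close>.  The form
  \<open>x\<^sup>2 + 4 * x * y + y\<^sup>2\<close> is \<open>2 * (x + y)\<^sup>2 - x\<^sup>2 - y\<^sup>2\<close>, and each square is interpolated separately;
  on a cell each interpolant is a single chord, so the result is affine there.\<close>

lemma (in plane_basis) grid_interpolant:
  fixes f :: "real \<times> real \<Rightarrow> real"
  assumes f: "\<And>x y. f (p + x *\<^sub>R u + y *\<^sub>R v) = c0 + c1 * x + c2 * y + P * (x\<^sup>2 + 4 * x * y + y\<^sup>2)"
    and "P \<ge> 0"
  shows "\<exists>h. piecewise_linear_wrt (grid_triangles p u v) h \<and> (\<forall>z. \<bar>f z - h z\<bar> \<le> 3 * P / 8)"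
proof -
  let ?L = square_interpolant
  \<comment> \<open>Before the shift by \<open>P / 8\<close>, \<open>h - f\<close> lies in \<open>[- P / 2, P / 4]\<close>, with midpoint \<open>- P / 8\<close>.\<close>
  define h where "h z = (let x = dual_u \<bullet> (z - p); y = dual_v \<bullet> (z - p) in
      c0 + c1 * x + c2 * y + P * (2 * ?L (x + y) - ?L x - ?L y) + P / 8)" for z
  have h_eq: "h (p + x *\<^sub>R u + y *\<^sub>R v) =
      c0 + c1 * x + c2 * y + P * (2 * ?L (x + y) - ?L x - ?L y) + P / 8" for x y
    by (simp add: h_def inner_add_right)
  have L: "continuous_on UNIV (\<lambda>z. ?L (g z))" if "continuous_on UNIV g" for g :: "real \<times> real \<Rightarrow> real"
    using continuous_on_compose2[OF continuous_on_square_interpolant that] by simp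
  have "continuous_on UNIV h"
    unfolding h_def Let_def by (intro continuous_intros L)
  moreover have "\<exists>l k. linear l \<and> (\<forall>z\<in>T. h z = l z + k)" if T: "T \<in> grid_triangles p u v" for T
  proof -
    obtain i j k where T_eq: "T = cell p i j k"
      using grid_triangle_is_cell[OF T] by blast
    define \<alpha> where "\<alpha> = c1 + P * (2 * (2 * of_int k + 1) - (2 * of_int i + 1))"
    define \<beta> where "\<beta> = c2 + P * (2 * (2 * of_int k + 1) - (2 * of_int j + 1))"
    define \<gamma> where "\<gamma> = c0 + P * (of_int i * (of_int i + 1) + of_int j * (of_int j + 1)
        - 2 * (of_int k * (of_int k + 1))) + P / 8"
    define l where "l = (\<lambda>z. (\<alpha> *\<^sub>R dual_u + \<beta> *\<^sub>R dual_v) \<bullet> z)"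
    have "linear l" unfolding l_def by (rule bounded_linear.linear[OF bounded_linear_inner_right])
    moreover have "h z = l z + (\<gamma> - l p)" if "z \<in> T" for z
    proof -
      obtain x y where z: "z = p + x *\<^sub>R u + y *\<^sub>R v" by (rule in_coordinates)
      have "of_int i \<le> x" "x \<le> of_int i + 1" "of_int j \<le> y" "y \<le> of_int j + 1"
          "of_int k \<le> x + y" "x + y \<le> of_int k + 1"
        using that unfolding T_eq z mem_cell_iff by auto
      then have "h z = \<alpha> * x + \<beta> * y + \<gamma>"
        unfolding z h_eq
        by (simp add: square_interpolant_on_unit_interval \<alpha>_def \<beta>_def \<gamma>_def algebra_simps)
      moreover have "l z = l p + \<alpha> * x + \<beta> * y"
        by (simp add: l_def z inner_add_left inner_add_right distrib_left)
      ultimately show ?thesis by simp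
    qed
    ultimately show ?thesis by blast
  qed
  moreover have "\<bar>f z - h z\<bar> \<le> 3 * P / 8" for z
  proof -
    obtain x y where z: "z = p + x *\<^sub>R u + y *\<^sub>R v" by (rule in_coordinates)
    define \<psi> where "\<psi> = 2 * (frac (x + y) * (1 - frac (x + y))) - frac x * (1 - frac x) - frac y * (1 - frac y)"
    have "h z - f z = P * (\<psi> + 1 / 8)"
      unfolding z h_eq f square_interpolant_eq_add_frac \<psi>_def by (simp add: power2_eq_square algebra_simps)
    moreover have "\<bar>\<psi> + 1 / 8\<bar> \<le> 3 / 8"
      using frac_combination_bounds[of x y] unfolding \<psi>_def by linarith
    then have "\<bar>P * (\<psi> + 1 / 8)\<bar> \<le> P * (3 / 8)"
      using mult_left_mono[of "\<bar>\<psi> + 1 / 8\<bar>" "3 / 8" P] \<open>P \<ge> 0\<close> by (simp add: abs_mult)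
    ultimately show ?thesis by linarith
  qed
  ultimately show ?thesis unfolding piecewise_linear_wrt_def by blast
qed

lemma (in plane_basis) translatable_grid_if_model_quadratic:
  fixes f :: "real \<times> real \<Rightarrow> real"
  assumes f: "\<And>p. \<exists>c0 c1 c2. \<forall>x y. f (p + x *\<^sub>R u + y *\<^sub>R v) =
      c0 + c1 * x + c2 * y + (8 * \<epsilon> / 3) * (x\<^sup>2 + 4 * x * y + y\<^sup>2)"
    and "\<epsilon> > 0"
  shows "translatable_grid f \<epsilon> (2 / \<bar>cross u v\<bar>) (grid_triangles p u v)"
proof -
  have "\<exists>h. piecewise_linear_wrt (grid_triangles q u v) h \<and> (\<forall>z. \<bar>f z - h z\<bar> \<le> \<epsilon>)" for q
  proof -
    obtain c0 c1 c2 where "\<And>x y. f (q + x *\<^sub>R u + y *\<^sub>R v) =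
        c0 + c1 * x + c2 * y + (8 * \<epsilon> / 3) * (x\<^sup>2 + 4 * x * y + y\<^sup>2)"
      using f by blast
    from grid_interpolant[OF this] \<open>\<epsilon> > 0\<close> show ?thesis by simp
  qed
  moreover have "triangular_grid (grid_triangles p u v)"
    using independent_if_cross_nonzero[OF cross_nonzero] plane_triangulation_grid
    unfolding triangular_grid_def by blast
  ultimately show ?thesis
    unfolding translatable_grid_def translate_grid_triangles
    by (intro conjI ballI allI plane_triangulation_grid triangle_density_grid grid_triangles_congruent)
qed

section \<open>Null directions of an indefinite form\<close>

definition quadratic_form :: "real \<Rightarrow> real \<Rightarrow> real \<Rightarrow> real \<times> real \<Rightarrow> real" where
  "quadratic_form a b c z = a * (fst z)\<^sup>2 + 2 * b * fst z * snd z + c * (snd z)\<^sup>2"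

text \<open>A binary form of negative determinant is a product of two independent linear forms, and \<open>k1, k2\<close>
  is the basis dual to suitable multiples of them.  The last property is the Gram determinant
  identity for \<open>k1, k2\<close>.\<close>

lemma null_basis:
  fixes a b c :: real
  assumes "b\<^sup>2 - a * c > 0"
  obtains k1 k2 :: "real \<times> real" where
    "\<And>x y. quadratic_form a b c (x *\<^sub>R k1 + y *\<^sub>R k2) = x * y"
    "norm k2 \<le> norm k1" "2 * sqrt (b\<^sup>2 - a * c) * \<bar>cross k1 k2\<bar> = 1"
proof -
  define \<Delta> where "\<Delta> = sqrt (b\<^sup>2 - a * c)"
  have \<Delta>: "\<Delta> > 0" "\<Delta>\<^sup>2 = b\<^sup>2 - a * c" using assms by (auto simp: \<Delta>_def)
  define B where "B k l = a * fst k * fst l + b * (fst k * snd l + snd k * fst l) + c * snd k * snd l"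
    for k l :: "real \<times> real"
  have expand: "B (x *\<^sub>R k + y *\<^sub>R l) (x *\<^sub>R k + y *\<^sub>R l) = x\<^sup>2 * B k k + 2 * x * y * B k l + y\<^sup>2 * B l l" for x y k l
    by (simp add: B_def power2_eq_square algebra_simps)
  have gram: "(B k l)\<^sup>2 - B k k * B l l = \<Delta>\<^sup>2 * (cross k l)\<^sup>2" for k l
    unfolding \<Delta> B_def cross_def by (simp add: power2_eq_square algebra_simps)
  obtain m n where mn: "B m m = 0" "B n n = 0" "cross m n \<noteq> 0"
  proof (cases "a = 0")
    case True
    then have "b \<noteq> 0" using assms by auto
    then show ?thesis
      using True by (intro that[of "(1, 0)" "(c, - 2 * b)"]) (auto simp: B_def cross_def)
  next
    case False
    \<comment> \<open>The null directions have ratio \<open>x / y\<close> equal to a root of \<open>a t\<^sup>2 + 2 b t + c\<close>; \<open>s\<close> is the sign of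
      the square root.\<close>
    have "B (- b + s * \<Delta>, a) (- b + s * \<Delta>, a) = 0" if "s\<^sup>2 = 1" for s
    proof -
      have "B (- b + s * \<Delta>, a) (- b + s * \<Delta>, a) = a * (s\<^sup>2 * \<Delta>\<^sup>2 - b\<^sup>2 + a * c)"
        by (simp add: B_def power2_eq_square algebra_simps)
      then show ?thesis using that \<Delta> by simp
    qed
    from this[of 1] this[of "-1"] show ?thesis
      using False \<Delta> by (intro that[of "(- b + 1 * \<Delta>, a)" "(- b + (-1) * \<Delta>, a)"]) (auto simp: cross_def algebra_simps)
  qed
  then have "B m n \<noteq> 0" using gram[of m n] \<Delta> by auto
  define n' where "n' = (1 / (2 * B m n)) *\<^sub>R n"
  have "B k (r *\<^sub>R l) = r * B k l" "B (r *\<^sub>R k) l = r * B k l" for k l r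
    by (simp_all add: B_def algebra_simps)
  then have n': "B n' n' = 0" "B m n' = 1 / 2"
    using mn \<open>B m n \<noteq> 0\<close> by (simp_all add: n'_def)
  have sym: "B k l = B l k" for k l by (simp add: B_def algebra_simps)
  \<comment> \<open>The conditions on \<open>B\<close> are symmetric in the two null vectors, so a longest one can be put first.\<close>
  obtain k1 k2 where k: "B k1 k1 = 0" "B k2 k2 = 0" "B k1 k2 = 1 / 2" "norm k2 \<le> norm k1"
  proof (cases "norm n' \<le> norm m")
    case True
    then show ?thesis using that[of m n'] mn n' by simp
  next
    case False
    then show ?thesis using that[of n' m] mn n' sym[of m n'] by simp
  qed
  show ?thesis
  proof (rule that[of k1 k2])
    have "quadratic_form a b c z = B z z" for z
      by (simp add: quadratic_form_def B_def power2_eq_square algebra_simps)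
    then show "quadratic_form a b c (x *\<^sub>R k1 + y *\<^sub>R k2) = x * y" for x y
      using expand[of x k1 y k2] k by simp
    have "\<Delta>\<^sup>2 * (cross k1 k2)\<^sup>2 = 1 / 4"
      using gram[of k1 k2] k by (simp add: power2_eq_square)
    then have "(2 * \<Delta> * \<bar>cross k1 k2\<bar>)\<^sup>2 = 1"
      by (simp add: power_mult_distrib)
    moreover have "2 * \<Delta> * \<bar>cross k1 k2\<bar> \<ge> 0" using \<Delta> by simp
    ultimately show "2 * sqrt (b\<^sup>2 - a * c) * \<bar>cross k1 k2\<bar> = 1"
      unfolding \<Delta>_def[symmetric] by (metis abs_of_nonneg power2_eq_1_iff abs_minus_cancel abs_one)
  qed (rule k)
qed

text \<open>The squared norm is a constant plus \<open>\<xi>\<^sup>2 * (norm k1)\<^sup>2 * s\<^sup>2 + \<eta>\<^sup>2 * (norm k2)\<^sup>2 / s\<^sup>2\<close>.  The first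
  coefficient dominates the second, and from \<open>s = 1\<close> on \<open>s\<^sup>2\<close> grows faster than \<open>1 / s\<^sup>2\<close> decreases.\<close>

lemma norm_hyperbolic_rotation_strict_mono:
  fixes k1 k2 :: "'a::real_inner"
  assumes "norm k2 \<le> norm k1" "k1 \<noteq> 0" "\<bar>\<eta>\<bar> \<le> \<bar>\<xi>\<bar>" "\<xi> \<noteq> 0" "1 \<le> s" "s < s'"
  shows "norm ((\<xi> * s) *\<^sub>R k1 + (\<eta> / s) *\<^sub>R k2) < norm ((\<xi> * s') *\<^sub>R k1 + (\<eta> / s') *\<^sub>R k2)"
proof -
  have sq: "(norm ((\<xi> * r) *\<^sub>R k1 + (\<eta> / r) *\<^sub>R k2))\<^sup>2 =
      \<xi>\<^sup>2 * (norm k1)\<^sup>2 * r\<^sup>2 + 2 * \<xi> * \<eta> * (k1 \<bullet> k2) + \<eta>\<^sup>2 * (norm k2)\<^sup>2 * (1 / r\<^sup>2)" if "r > 0" for r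
    using that unfolding power2_norm_eq_inner
    by (simp add: inner_add_left inner_add_right inner_commute[of k2 k1] power2_eq_square field_simps)
  have gap: "1 / s\<^sup>2 - 1 / s'\<^sup>2 < s'\<^sup>2 - s\<^sup>2"
  proof -
    have less: "s\<^sup>2 < s'\<^sup>2" "1 \<le> s\<^sup>2" using assms by (auto simp: power_strict_mono)
    then have "1 * 1 < s\<^sup>2 * s'\<^sup>2" by (intro mult_le_less_imp_less) auto
    then have "(s'\<^sup>2 - s\<^sup>2) / (s\<^sup>2 * s'\<^sup>2) < s'\<^sup>2 - s\<^sup>2"
      using less by (simp add: divide_less_eq)
    moreover have "1 / s\<^sup>2 - 1 / s'\<^sup>2 = (s'\<^sup>2 - s\<^sup>2) / (s\<^sup>2 * s'\<^sup>2)"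
      using assms by (simp add: divide_simps)
    ultimately show ?thesis by simp
  qed
  have gap_nonneg: "0 \<le> 1 / s\<^sup>2 - 1 / s'\<^sup>2"
    using assms by (simp add: frac_le power_mono)
  have "\<eta>\<^sup>2 * (norm k2)\<^sup>2 \<le> \<xi>\<^sup>2 * (norm k1)\<^sup>2"
    using assms by (intro mult_mono) (auto simp: abs_le_square_iff power_mono)
  then have "\<eta>\<^sup>2 * (norm k2)\<^sup>2 * (1 / s\<^sup>2 - 1 / s'\<^sup>2) \<le> \<xi>\<^sup>2 * (norm k1)\<^sup>2 * (1 / s\<^sup>2 - 1 / s'\<^sup>2)"
    using gap_nonneg by (rule mult_right_mono)
  also have "\<dots> < \<xi>\<^sup>2 * (norm k1)\<^sup>2 * (s'\<^sup>2 - s\<^sup>2)"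
    using gap assms by (intro mult_strict_left_mono) auto
  finally have "(norm ((\<xi> * s) *\<^sub>R k1 + (\<eta> / s) *\<^sub>R k2))\<^sup>2 < (norm ((\<xi> * s') *\<^sub>R k1 + (\<eta> / s') *\<^sub>R k2))\<^sup>2"
    using assms by (simp add: sq algebra_simps)
  then show ?thesis by (rule power_less_imp_less_base) simp
qed

theorem theorem1:
  fixes a b c d e g \<epsilon> :: real and f :: "real \<times> real \<Rightarrow> real"
  assumes "a * c - b\<^sup>2 < 0"
    and "f = (\<lambda>(x, y). a * x\<^sup>2 + 2 * b * x * y + c * y\<^sup>2 + d * x + e * y + g)"
    and "\<epsilon> > 0"
  shows "(\<exists>\<T> h. plane_triangulation \<T> \<and> piecewise_linear_wrt \<T> h \<and>
            (\<forall>x y. \<bar>f (x, y) - h (x, y)\<bar> \<le> \<epsilon>) \<and>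
            triangle_density \<T> = ereal (sqrt 3 / 4 * sqrt (b\<^sup>2 - a * c) * (1 / \<epsilon>)) \<and>
            translatable_grid f \<epsilon> (sqrt 3 / 4 * sqrt (b\<^sup>2 - a * c) * (1 / \<epsilon>)) \<T>) \<and>
         (\<exists>(I :: real set) p u v.
            is_interval I \<and> (\<exists>s\<in>I. \<exists>s'\<in>I. s \<noteq> s') \<and>
            continuous_on I p \<and> continuous_on I u \<and> continuous_on I v \<and>
            (\<forall>s\<in>I. translatable_grid f \<epsilon> (sqrt 3 / 4 * sqrt (b\<^sup>2 - a * c) * (1 / \<epsilon>))
                      (grid_triangles (p s) (u s) (v s))) \<and>
            (\<forall>s\<in>I. \<forall>s'\<in>I. s \<noteq> s' \<longrightarrow>
               (\<forall>T\<in>grid_triangles (p s) (u s) (v s).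
                  \<forall>T'\<in>grid_triangles (p s') (u s') (v s'). \<not> congruent_sets T T')))"
proof -
  let ?D = "sqrt 3 / 4 * sqrt (b\<^sup>2 - a * c) * (1 / \<epsilon>)"
  \<comment> \<open>The factors of the model form: \<open>x\<^sup>2 + 4 x y + y\<^sup>2 = (x + \<tau> y) (x + \<tau>' y)\<close>.\<close>
  define \<tau> \<tau>' where "\<tau> = 2 + sqrt 3" and "\<tau>' = 2 - sqrt 3"
  define P where "P = 8 * \<epsilon> / 3"
  have P: "P > 0" using assms(3) by (simp add: P_def)
  have disc: "b\<^sup>2 - a * c > 0" using assms(1) by simp
  obtain k1 k2 where
    k: "\<And>x y. quadratic_form a b c (x *\<^sub>R k1 + y *\<^sub>R k2) = x * y"
    and norm_k: "norm k2 \<le> norm k1" and cross_k: "2 * sqrt (b\<^sup>2 - a * c) * \<bar>cross k1 k2\<bar> = 1"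
    using null_basis[OF disc] by metis
  have "k1 \<noteq> 0" using cross_k by (auto simp: cross_def)
  define edge where "edge \<xi> \<eta> s = sqrt P *\<^sub>R ((\<xi> * s) *\<^sub>R k1 + (\<eta> / s) *\<^sub>R k2)" for \<xi> \<eta> s :: real
  \<comment> \<open>In the null coordinates, \<open>x u + y v\<close> has the entries \<open>sqrt P * s * (x + \<tau> y)\<close> and
      \<open>sqrt P / s * (x + \<tau>' y)\<close>, so their product is \<open>P * (x\<^sup>2 + 4 x y + y\<^sup>2)\<close> for every \<open>s\<close>.\<close>
  define u v where "u = edge 1 1" and "v = edge \<tau> \<tau>'"
  have diff: "u s - v s = edge (1 - \<tau>) (1 - \<tau>') s" for s
    by (simp add: u_def v_def edge_def algebra_simps diff_divide_distrib)
  have cross_uv: "\<bar>cross (u s) (v s)\<bar> = P * (2 * sqrt 3) * \<bar>cross k1 k2\<bar>" if "s > 0" for s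
  proof -
    have cross_edge: "cross (edge \<xi> \<eta> s) (edge \<xi>' \<eta>' s) =
        (sqrt P)\<^sup>2 * ((\<xi> * s) * (\<eta>' / s) - (\<eta> / s) * (\<xi>' * s)) * cross k1 k2" for \<xi> \<eta> \<xi>' \<eta>'
      unfolding edge_def cross_def power2_eq_square by (simp del: real_sqrt_mult_self add: algebra_simps)
    have "cross (u s) (v s) = P * (\<tau>' - \<tau>) * cross k1 k2"
      unfolding u_def v_def cross_edge using that P by simp
    then show ?thesis using P by (simp add: abs_mult \<tau>_def \<tau>'_def)
  qed
  have density: "2 / \<bar>cross (u s) (v s)\<bar> = ?D" if "s > 0" for s
  proof -
    have "\<bar>cross k1 k2\<bar> = 1 / (2 * sqrt (b\<^sup>2 - a * c))"
      using cross_k disc by (simp add: field_simps)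
    then have "2 / \<bar>cross (u s) (v s)\<bar> = 2 * (2 * sqrt (b\<^sup>2 - a * c)) / (P * (2 * sqrt 3))"
      using cross_uv[OF that] by simp
    also have "\<dots> = 2 * (2 * sqrt (b\<^sup>2 - a * c)) * sqrt 3 / (P * (2 * (sqrt 3)\<^sup>2))"
    proof -
      have "S / (P * (2 * q)) = S * q / (P * (2 * q\<^sup>2))" if "q \<noteq> 0" for S q :: real
        using that P by (simp add: power2_eq_square field_simps)
      then show ?thesis by simp
    qed
    also have "\<dots> = ?D" using assms(3) by (simp add: P_def field_simps)
    finally show ?thesis .
  qed
  have quad: "\<exists>c0 c1 c2. \<forall>x y. f (p + x *\<^sub>R u s + y *\<^sub>R v s) =
      c0 + c1 * x + c2 * y + (8 * \<epsilon> / 3) * (x\<^sup>2 + 4 * x * y + y\<^sup>2)" if "s > 0" for p s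
  proof -
    let ?lin = "\<lambda>w. 2 * (a * fst p * fst w + b * (fst p * snd w + snd p * fst w) + c * snd p * snd w)
        + d * fst w + e * snd w"
    have f_add: "f (p + w) = f p + ?lin w + quadratic_form a b c w" for w
      unfolding assms(2) quadratic_form_def by (simp add: case_prod_beta power2_eq_square algebra_simps)
    have "f (p + x *\<^sub>R u s + y *\<^sub>R v s) =
      f p + ?lin (u s) * x + ?lin (v s) * y + (8 * \<epsilon> / 3) * (x\<^sup>2 + 4 * x * y + y\<^sup>2)" for x y
    proof -
      let ?w = "x *\<^sub>R u s + y *\<^sub>R v s"
      have w: "?w = (sqrt P * s * (x + y * \<tau>)) *\<^sub>R k1 + (sqrt P / s * (x + y * \<tau>')) *\<^sub>R k2"
        by (simp add: u_def v_def edge_def algebra_simps)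
      have "quadratic_form a b c ?w =
          (sqrt P * s * (x + y * \<tau>)) * (sqrt P / s * (x + y * \<tau>'))"
        unfolding w by (rule k)
      also have "\<dots> = (sqrt P)\<^sup>2 * ((x + y * \<tau>) * (x + y * \<tau>'))"
        using that by (simp add: power2_eq_square)
      also have "(x + y * \<tau>) * (x + y * \<tau>') = x\<^sup>2 + 4 * x * y + (4 - (sqrt 3)\<^sup>2) * y\<^sup>2"
        unfolding \<tau>_def \<tau>'_def by (simp only: power2_eq_square) (simp add: algebra_simps)
      finally have "quadratic_form a b c ?w =
          (8 * \<epsilon> / 3) * (x\<^sup>2 + 4 * x * y + y\<^sup>2)"
        using P by (simp add: P_def)
      moreover have "?lin ?w = ?lin (u s) * x + ?lin (v s) * y"
        by (simp add: algebra_simps)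
      ultimately show ?thesis
        using f_add[of ?w] by (simp only: add.assoc)
    qed
    then show ?thesis by blast
  qed
  have grid: "translatable_grid f \<epsilon> ?D (grid_triangles 0 (u s) (v s))" if "s > 0" for s
  proof -
    have "cross (u s) (v s) \<noteq> 0" using density[OF that] disc assms(3) by force
    then interpret plane_basis "u s" "v s" by unfold_locales
    show ?thesis
      using translatable_grid_if_model_quadratic[OF quad[OF that] assms(3), of 0]
      unfolding density[OF that] .
  qed
  have longest_mono: "longest_edge (u s) (v s) < longest_edge (u s') (v s')" if "1 \<le> s" "s < s'" for s s'
  proof -
    have mono: "norm (edge \<xi> \<eta> s) < norm (edge \<xi> \<eta> s')" if "\<bar>\<eta>\<bar> \<le> \<bar>\<xi>\<bar>" "\<xi> \<noteq> 0" for \<xi> \<eta>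
      unfolding edge_def norm_scaleR
      using norm_hyperbolic_rotation_strict_mono[OF norm_k \<open>k1 \<noteq> 0\<close> that \<open>1 \<le> s\<close> \<open>s < s'\<close>] P
      by simp
    have "1 \<le> sqrt 3" "sqrt 3 \<le> 2" by (auto intro: real_le_rsqrt real_le_lsqrt)
    then have \<tau>: "\<tau> \<noteq> 0" "1 - \<tau> \<noteq> 0" "\<bar>\<tau>'\<bar> \<le> \<bar>\<tau>\<bar>" "\<bar>1 - \<tau>'\<bar> \<le> \<bar>1 - \<tau>\<bar>"
      unfolding \<tau>_def \<tau>'_def by linarith+
    have "norm (u s) < norm (u s')" "norm (v s) < norm (v s')" "norm (u s - v s) < norm (u s' - v s')"
      unfolding diff unfolding u_def v_def using \<tau> by (auto intro!: mono)
    then show ?thesis by (auto simp: longest_edge_def)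
  qed
  have first: "\<exists>\<T> h. plane_triangulation \<T> \<and> piecewise_linear_wrt \<T> h \<and>
            (\<forall>x y. \<bar>f (x, y) - h (x, y)\<bar> \<le> \<epsilon>) \<and> triangle_density \<T> = ereal ?D \<and>
            translatable_grid f \<epsilon> ?D \<T>"
  proof -
    let ?T = "grid_triangles 0 (u 1) (v 1)"
    have "translatable_grid f \<epsilon> ?D ?T" by (rule grid) simp
    moreover have "translate_triangles 0 ?T = ?T" by (simp add: translate_grid_triangles)
    ultimately show ?thesis unfolding translatable_grid_def by metis
  qed
  have edge_cont: "continuous_on {1..2} (edge \<xi> \<eta>)" for \<xi> \<eta>
    unfolding edge_def by (intro continuous_intros) auto
  have noncongruent: "\<not> congruent_sets T T'"
    if "s \<in> {1..2}" "s' \<in> {1..2}" "s \<noteq> s'"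
      "T \<in> grid_triangles 0 (u s) (v s)" "T' \<in> grid_triangles 0 (u s') (v s')" for s s' T T'
    using congruent_grid_triangles_longest_edge[OF that(4,5)]
      longest_mono[of s s'] longest_mono[of s' s] that(1-3)
    by (cases "s < s'") auto
  have "\<exists>(I :: real set) p u v.
            is_interval I \<and> (\<exists>s\<in>I. \<exists>s'\<in>I. s \<noteq> s') \<and>
            continuous_on I p \<and> continuous_on I u \<and> continuous_on I v \<and>
            (\<forall>s\<in>I. translatable_grid f \<epsilon> ?D (grid_triangles (p s) (u s) (v s))) \<and>
            (\<forall>s\<in>I. \<forall>s'\<in>I. s \<noteq> s' \<longrightarrow>
               (\<forall>T\<in>grid_triangles (p s) (u s) (v s).
                  \<forall>T'\<in>grid_triangles (p s') (u s') (v s'). \<not> congruent_sets T T'))"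
  proof (rule exI[of _ "{1..2}"], rule exI[of _ "\<lambda>_. 0"], rule exI[of _ u], rule exI[of _ v], intro conjI)
    show "\<exists>s\<in>{1..2::real}. \<exists>s'\<in>{1..2}. s \<noteq> s'"
      by (intro bexI[of _ 1] bexI[of _ 2]) auto
    show "continuous_on {1..2} u" "continuous_on {1..2} v"
      unfolding u_def v_def by (rule edge_cont)+
    show "\<forall>s\<in>{1..2}. translatable_grid f \<epsilon> ?D (grid_triangles 0 (u s) (v s))"
      using grid by simp
    show "\<forall>s\<in>{1..2}. \<forall>s'\<in>{1..2}. s \<noteq> s' \<longrightarrow>
        (\<forall>T\<in>grid_triangles 0 (u s) (v s). \<forall>T'\<in>grid_triangles 0 (u s') (v s'). \<not> congruent_sets T T')"
      using noncongruent by blast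
  qed (simp_all add: is_interval_cc)
  with first show ?thesis by blast
qed

end
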